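(* Let $d\ge 1$, let $s\in\mathbb R^d$ be a vector with positive entries, and let $*:\mathbb R^d\times\mathbb R^d\to\mathbb R^d$ be a bilinear map with nonnegative coefficients, with growth function $g(n)$. Then the limit $\lambda=\lim_{n\to\infty}\sqrt[n]{g(n)}$ exists and \[ \lambda=\sup_P\max_{1\le i\le d}\sqrt[|P|]{M(P)_{i,i}}, \] where the supremum is over all linear patterns $P$ with $|P|\ge 1$.
   Context: The map $*$ has the form $(x*y)_k=\sum_{i,j}c^{(k)}_{i,j}x_iy_j$ with all $c^{(k)}_{i,j}\ge 0$, where $x_i$ denotes the $i$-th entry of a vector $x$. Define $A_1=\{s\}$ and, for $n\ge 2$, $A_n=\bigcup_{1\le m\le n-1}\{x*y: x\in A_m,\ y\in A_{n-m}\}$, and $g(n)=\max\{v_i: v\in A_n,\ 1\le i\le d\}$. A tree means a rooted binary tree in which every non-leaf vertex has a left branch and a right branch. The expression associated with a single-leaf tree is $s$; the expression associated with a larger tree is $L*R$, where $L,R$ are the expressions associated with its left and right branches. A linear pattern $P=(T,\ell)$ is a tree $T$ with a marked leaf $\ell$. Replacing the instance of $s$ at $\ell$ by a variable vector $u$ in the expression associated with $T$, its value is $v=Mu$ for a $d\times d$ matrix $M=M(P)$, called the matrix associated with $P$. $|P|$ denotes the number of leaves of $T$ excluding $\ell$. *)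

theory Defs
  imports "HOL-Analysis.Analysis"
begin

definition nonneg_bilinear :: "(real ^ 'd \<Rightarrow> real ^ 'd \<Rightarrow> real ^ 'd) \<Rightarrow> bool" where
  "nonneg_bilinear op \<longleftrightarrow>
     (\<exists>c :: 'd \<Rightarrow> 'd \<Rightarrow> 'd \<Rightarrow> real. (\<forall>k i j. c k i j \<ge> 0) \<and>
        (\<forall>x y k. op x y $ k = (\<Sum>i\<in>UNIV. \<Sum>j\<in>UNIV. c k i j * x $ i * y $ j)))"

lemma nonneg_bilinear_imp_bilinear: "nonneg_bilinear op \<Longrightarrow> bilinear op"
  unfolding nonneg_bilinear_def bilinear_def
  by (auto intro!: linearI simp: vec_eq_iff algebra_simps sum.distrib sum_distrib_left)

text \<open>The values of all bracketings of \<open>n\<close> copies of \<open>s\<close>; for \<open>n = 0\<close> the union is empty.\<close>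

function products :: "('v \<Rightarrow> 'v \<Rightarrow> 'v) \<Rightarrow> 'v \<Rightarrow> nat \<Rightarrow> 'v set" where
  "products op s n =
     (if n = 1 then {s}
      else (\<Union>m\<in>{1..n - 1}. {op x y |x y. x \<in> products op s m \<and> y \<in> products op s (n - m)}))"
  by pat_completeness auto
termination by (relation "Wellfounded.measure (\<lambda>(op, s, n). n)") auto

declare products.simps [simp del]

definition growth :: "(real ^ 'd \<Rightarrow> real ^ 'd \<Rightarrow> real ^ 'd) \<Rightarrow> real ^ 'd \<Rightarrow> nat \<Rightarrow> real" where
  "growth op s n = Max {v $ i |v i. v \<in> products op s n}"

text \<open>The maximum is over a finite set, which is nonempty for \<open>n \<ge> 1\<close>.\<close>

lemma finite_products: "finite (products op s n)"
proof (induction n rule: less_induct)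
  case (less n)
  have "finite {op x y |x y. x \<in> products op s m \<and> y \<in> products op s (n - m)}"
    if "m \<in> {1..n - 1}" for m
  proof -
    have "finite (products op s m)" "finite (products op s (n - m))"
      using that by (auto intro!: less.IH)
    then show ?thesis
      using finite_image_set2[of "\<lambda>x. x \<in> products op s m" "\<lambda>y. y \<in> products op s (n - m)" op] by simp
  qed
  then show ?case
    by (subst products.simps) auto
qed

lemma products_nonempty: "n \<ge> 1 \<Longrightarrow> products op s n \<noteq> {}"
proof (induction n rule: less_induct)
  case (less n)
  show ?case
  proof (cases "n = 1")
    case False
    then have "n \<ge> 2" using less.prems by simp
    then have "products op s 1 \<noteq> {}" "products op s (n - 1) \<noteq> {}"
      using less.IH[of 1] less.IH[of "n - 1"] by auto
    then show ?thesis
      using False \<open>n \<ge> 2\<close> by (subst products.simps) force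
  qed (subst products.simps, simp)
qed

datatype btree = Leaf | Node btree btree

datatype dir = Lft | Rgt

text \<open>A leaf is identified with the path leading to it from the root.\<close>

fun leaves :: "btree \<Rightarrow> dir list set" where
  "leaves Leaf = {[]}"
| "leaves (Node l r) = (#) Lft ` leaves l \<union> (#) Rgt ` leaves r"

text \<open>The value of the expression of a tree in which the leaf at path \<open>p\<close> stands for the
  vector \<open>f p\<close>; the plain expression of a tree is the case \<open>f = (\<lambda>_. s)\<close>.\<close>

fun tree_val :: "('v \<Rightarrow> 'v \<Rightarrow> 'v) \<Rightarrow> (dir list \<Rightarrow> 'v) \<Rightarrow> btree \<Rightarrow> 'v" where
  "tree_val op f Leaf = f []"
| "tree_val op f (Node l r) =
     op (tree_val op (\<lambda>p. f (Lft # p)) l) (tree_val op (\<lambda>p. f (Rgt # p)) r)"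

definition linear_patterns :: "(btree \<times> dir list) set" where
  "linear_patterns = {(T, p). p \<in> leaves T}"

fun pattern_size :: "btree \<times> dir list \<Rightarrow> nat" where
  "pattern_size (T, p) = card (leaves T - {p})"

fun pattern_val ::
  "(real ^ 'd \<Rightarrow> real ^ 'd \<Rightarrow> real ^ 'd) \<Rightarrow> real ^ 'd \<Rightarrow> btree \<times> dir list \<Rightarrow> real ^ 'd \<Rightarrow> real ^ 'd"
where
  "pattern_val op s (T, p) u = tree_val op ((\<lambda>_. s)(p := u)) T"

definition pattern_matrix ::
  "(real ^ 'd \<Rightarrow> real ^ 'd \<Rightarrow> real ^ 'd) \<Rightarrow> real ^ 'd \<Rightarrow> btree \<times> dir list \<Rightarrow> real ^ 'd ^ 'd"
where
  "pattern_matrix op s P = matrix (pattern_val op s P)"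

lemma linear_tree_val:
  assumes "bilinear op" "p \<in> leaves T"
  shows "linear (\<lambda>u. tree_val op (f(p := u)) T)"
  using assms(2)
proof (induction T arbitrary: p f)
  case Leaf
  then show ?case by (simp add: linear_id[unfolded id_def])
next
  case (Node l r)
  have upd: "(\<lambda>q. (f(d # p' := u)) (d' # q)) =
      (if d = d' then (\<lambda>q. f (d' # q))(p' := u) else (\<lambda>q. f (d' # q)))" for d d' p' u
    by auto
  have bl: "linear (\<lambda>x. op x y)" "linear (op y)" for y
    using assms(1) unfolding bilinear_def by auto
  consider p' where "p = Lft # p'" "p' \<in> leaves l" | p' where "p = Rgt # p'" "p' \<in> leaves r"
    using Node.prems by auto
  then show ?case
  proof cases
    case 1
    show ?thesis
      using linear_compose[OF Node.IH(1)[OF 1(2)] bl(1)]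
      by (simp add: 1(1) upd o_def del: fun_upd_apply)
  next
    case 2
    show ?thesis
      using linear_compose[OF Node.IH(2)[OF 2(2)] bl(2)]
      by (simp add: 2(1) upd o_def del: fun_upd_apply)
  qed
qed

lemma pattern_val_eq_matrix_mult:
  assumes "nonneg_bilinear op" "P \<in> linear_patterns"
  shows "pattern_val op s P u = pattern_matrix op s P *v u"
proof -
  obtain T p where P: "P = (T, p)" "p \<in> leaves T"
    using assms(2) by (auto simp: linear_patterns_def)
  then have "linear (pattern_val op s P)"
    using linear_tree_val[OF nonneg_bilinear_imp_bilinear[OF assms(1)] P(2), of "\<lambda>_. s"]
    unfolding P(1) pattern_val.simps[abs_def] by blast
  then show ?thesis
    by (simp add: pattern_matrix_def matrix_works)
qed

end

theory Submission
  imports Defs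
begin

text \<open>
  Write \<open>\<theta>\<close> for the supremum of the numbers \<open>root m M\<^sub>i\<^sub>i\<close> over all patterns with
  \<open>m \<ge> 1\<close> leaves besides the marked one. The growth cannot be slower than \<open>\<theta>\<close>, because a pattern
  can be substituted into itself: \<open>k\<close> copies of a pattern multiply the \<open>i\<close>-th coordinate of what
  is put into the marked leaf by at least \<open>M\<^sub>i\<^sub>i ^ k\<close>. To reach every size, and not only the
  sizes in one residue class modulo \<open>m\<close>, one needs bracketings of each size \<open>1, \<dots>, m\<close> with
  a positive \<open>i\<close>-th coordinate to start from. They exist because an index with a positive diagonal
  entry has a successor of the same kind along a nonzero coefficient, so that
  arbitrarily long combs ending in the positive vector \<open>s\<close> are positive at \<open>i\<close>
  (\<open>recurrent_positive_value\<close>, \<open>values_ge_geometric\<close>).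

  The growth cannot be faster than \<open>\<theta>\<close> either, which is the harder half
  (\<open>value_bound_above_diagonal_rate\<close>). Say that \<open>i\<close> reaches \<open>j\<close> if some pattern has a positive entry
  at \<open>(i, j)\<close>. If \<open>i\<close> and \<open>j\<close> reach each other, then closing a pattern up by a fixed one leading
  back from \<open>j\<close> to \<open>i\<close> turns its \<open>(i, j)\<close> entry into part of a diagonal entry, so \<open>(i, j)\<close> entries
  are \<open>O(\<theta> ^ m)\<close>. For a coordinate \<open>i\<close> of a large bracketing, follow the path from the root
  that always enters the larger factor, and expand the product along it into walks of indices. A
  walk either stays in the strongly connected component of \<open>i\<close> down to the last leaf, and is then
  controlled by the entries within the component, or leaves it at some vertex of the path. In
  the second case the larger factor is evaluated at an index that reaches strictly fewer indices
  and is controlled by induction on that number, and the smaller factor has at most half of the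
  leaves. So, if \<open>F n\<close> denotes the maximum over size \<open>n\<close> of the coordinates that \<open>i\<close> reaches, divided
  by \<open>\<mu> ^ n\<close> for a fixed \<open>\<mu> > \<theta>\<close>, one gets a recursion of the form
  \<open>F n \<le> const \<cdot> (1 + n \<cdot> max {F k |k. k \<le> n / 2})\<close>
  (\<open>heavy_path_descent\<close>). This makes \<open>F\<close> subexponential, and \<open>\<mu>\<close> can be as close to \<open>\<theta>\<close> as one likes.
\<close>

section \<open>Bracketings, trees and marked leaves\<close>

lemma products_zero [simp]: "products op s 0 = {}"
  by (subst products.simps) simp

lemma products_generator: "s \<in> products op s 1"
  by (subst products.simps) simp

lemma products_size_pos: "x \<in> products op s n \<Longrightarrow> 1 \<le> n"
  by (cases n) auto

lemma products_op:
  assumes "y \<in> products op s m" "z \<in> products op s k"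
  shows "op y z \<in> products op s (m + k)"
proof -
  have "1 \<le> m" "1 \<le> k" using assms by (auto dest: products_size_pos)
  then have "m \<in> {1..m + k - 1}" "m + k - m = k" "m + k \<noteq> 1" by auto
  with assms show ?thesis by (subst products.simps) (force simp del: One_nat_def)
qed

lemma products_induct [consumes 1, case_names generator product]:
  assumes "x \<in> products op s n"
    and "P 1 s"
    and step: "\<And>m k y z. \<lbrakk>y \<in> products op s m; z \<in> products op s k; P m y; P k z\<rbrakk>
      \<Longrightarrow> P (m + k) (op y z)"
  shows "P n x"
  using assms(1)
proof (induction n arbitrary: x rule: less_induct)
  case (less n)
  show ?case
  proof (cases "n = 1")
    case True
    then have "x = s" using less.prems by (subst (asm) products.simps) simp
    then show ?thesis using True assms(2) by simp
  next
    case False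
    then obtain m y z where m: "m \<in> {1..n - 1}" and x: "x = op y z"
      and y: "y \<in> products op s m" and z: "z \<in> products op s (n - m)"
      using less.prems by (subst (asm) products.simps) auto
    then have "m < n" "n - m < n" "n = m + (n - m)" by auto
    then show ?thesis using step[OF y z] less.IH y z x by metis
  qed
qed

lemma finite_leaves [simp]: "finite (leaves T)"
  by (induction T) auto

lemma card_leaves_Node: "card (leaves (Node l r)) = card (leaves l) + card (leaves r)"
proof -
  have "card ((#) Lft ` leaves l \<union> (#) Rgt ` leaves r)
      = card ((#) Lft ` leaves l) + card ((#) Rgt ` leaves r)"
    by (rule card_Un_disjoint) auto
  then show ?thesis by (simp add: card_image)
qed

lemma tree_val_in_products: "tree_val op (\<lambda>_. s) T \<in> products op s (card (leaves T))"
  by (induction T)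
    (use products_generator products_op in \<open>auto simp: card_leaves_Node simp del: leaves.simps(2)\<close>)

lemma products_imp_tree:
  assumes "x \<in> products op s n"
  shows "\<exists>T. card (leaves T) = n \<and> tree_val op (\<lambda>_. s) T = x"
  using assms
proof (induction rule: products_induct)
  case generator
  show ?case by (rule exI[of _ Leaf]) simp
next
  case (product m k y z)
  then obtain l r where "card (leaves l) = m" "tree_val op (\<lambda>_. s) l = y"
    "card (leaves r) = k" "tree_val op (\<lambda>_. s) r = z" by blast
  then show ?case
    by (intro exI[of _ "Node l r"]) (simp add: card_leaves_Node del: leaves.simps(2))
qed

lemma pattern_size_Node:
  assumes "p \<in> leaves l" "q \<in> leaves r"
  shows "pattern_size (Node l r, Lft # p) = pattern_size (l, p) + card (leaves r)"
    and "pattern_size (Node l r, Rgt # q) = pattern_size (r, q) + card (leaves l)"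
proof -
  have "0 < card (leaves l)" "0 < card (leaves r)" using assms by (auto simp: card_gt_0_iff)
  moreover have "Lft # p \<in> leaves (Node l r)" "Rgt # q \<in> leaves (Node l r)" using assms by auto
  ultimately show "pattern_size (Node l r, Lft # p) = pattern_size (l, p) + card (leaves r)"
    and "pattern_size (Node l r, Rgt # q) = pattern_size (r, q) + card (leaves l)"
    using assms by (auto simp: card_Diff_singleton card_leaves_Node simp del: leaves.simps(2))
qed

lemma pattern_val_Node:
  fixes s :: "real ^ 'd"
  shows
  "pattern_val op s (Node l r, Lft # p)
    = (\<lambda>u. op (pattern_val op s (l, p) u) (tree_val op (\<lambda>_. s) r))"
  "pattern_val op s (Node l r, Rgt # p)
    = (\<lambda>u. op (tree_val op (\<lambda>_. s) l) (pattern_val op s (r, p) u))"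
proof -
  have "(\<lambda>q. ((\<lambda>_. s)(d # p := u)) (d' # q)) = (if d = d' then (\<lambda>_. s)(p := u) else (\<lambda>_. s))"
    for d d' and u
    by auto
  then show "pattern_val op s (Node l r, Lft # p)
    = (\<lambda>u. op (pattern_val op s (l, p) u) (tree_val op (\<lambda>_. s) r))"
  "pattern_val op s (Node l r, Rgt # p)
    = (\<lambda>u. op (tree_val op (\<lambda>_. s) l) (pattern_val op s (r, p) u))"
    by (auto simp del: fun_upd_apply)
qed

lemma leaves_nonempty: "leaves T \<noteq> {}"
  by (induction T) auto

section \<open>Elementary estimates\<close>

lemma uniform_constant:
  fixes h :: "'a \<Rightarrow> 't \<Rightarrow> real"
  assumes "finite A" and "0 \<le> r"
    and "\<And>a. a \<in> A \<Longrightarrow> \<exists>K. \<forall>n t. Q n t \<longrightarrow> h a t \<le> K * r ^ n"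
  shows "\<exists>K\<ge>1. \<forall>a\<in>A. \<forall>n t. Q n t \<longrightarrow> h a t \<le> K * r ^ n"
proof -
  obtain k where k: "\<And>a n t. a \<in> A \<Longrightarrow> Q n t \<Longrightarrow> h a t \<le> k a * r ^ n"
    using assms(3) by metis
  define K where "K = 1 + (\<Sum>a\<in>A. \<bar>k a\<bar>)"
  have "h a t \<le> K * r ^ n" if "a \<in> A" "Q n t" for a n t
  proof -
    have "\<bar>k a\<bar> \<le> (\<Sum>a\<in>A. \<bar>k a\<bar>)" using assms(1) that(1) by (intro member_le_sum) auto
    then have "k a \<le> K" by (simp add: K_def)
    then have "k a * r ^ n \<le> K * r ^ n" using assms(2) by (intro mult_right_mono) auto
    then show ?thesis using k[OF that] by simp
  qed
  moreover have "1 \<le> K" by (simp add: K_def sum_nonneg)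
  ultimately show ?thesis by blast
qed

text \<open>
  Here \<open>w\<close> will be the array of coefficients, \<open>F\<close> a row of a pattern matrix and \<open>y\<close>, \<open>z\<close> the two
  factors of a product: the sum collects the walks that go from \<open>j \<in> C\<close> to \<open>b \<notin> C\<close> in this very
  product. The bounds on \<open>y\<close> and \<open>z\<close> are demanded only at the indices joined by a positive
  coefficient, since nothing is known about the others.
\<close>

lemma leak_bound:
  fixes F y z :: "'d::finite \<Rightarrow> real"
  assumes F: "\<And>j. j \<in> C \<Longrightarrow> 0 \<le> F j" "\<And>j. j \<in> C \<Longrightarrow> F j \<le> A" and "0 \<le> A"
    and w: "\<And>j b k. 0 \<le> w j b k"
    and yz: "\<And>b. 0 \<le> y b" "\<And>k. 0 \<le> z k" and YZ: "0 \<le> Y" "0 \<le> Z"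
    and le: "\<And>j b k. j \<in> C \<Longrightarrow> b \<notin> C \<Longrightarrow> 0 < w j b k \<Longrightarrow> y b \<le> Y \<and> z k \<le> Z"
  shows "(\<Sum>j\<in>C. \<Sum>b\<in>-C. F j * ((\<Sum>k\<in>UNIV. w j b k * z k) * y b))
    \<le> A * (\<Sum>j\<in>UNIV. \<Sum>b\<in>UNIV. \<Sum>k\<in>UNIV. w j b k) * (Z * Y)"
proof -
  have termwise: "F j * (w j b k * z k * y b) \<le> A * w j b k * (Z * Y)" if "j \<in> C" "b \<notin> C" for j b k
  proof (cases "w j b k = 0")
    case False
    then have "0 < w j b k" using w[of j b k] by simp
    from le[OF that this] have "z k * y b \<le> Z * Y" using yz YZ by (intro mult_mono) auto
    moreover have "F j * w j b k \<le> A * w j b k"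
      using F(2)[OF that(1)] w by (rule mult_right_mono)
    ultimately have "(F j * w j b k) * (z k * y b) \<le> (A * w j b k) * (Z * Y)"
      using w yz \<open>0 \<le> A\<close> by (intro mult_mono[of "F j * w j b k"]) auto
    then show ?thesis by (simp add: mult_ac)
  qed simp
  have "(\<Sum>j\<in>C. \<Sum>b\<in>-C. F j * ((\<Sum>k\<in>UNIV. w j b k * z k) * y b))
      = (\<Sum>j\<in>C. \<Sum>b\<in>-C. \<Sum>k\<in>UNIV. F j * (w j b k * z k * y b))"
    by (simp only: sum_distrib_left sum_distrib_right)
  also have "\<dots> \<le> (\<Sum>j\<in>C. \<Sum>b\<in>-C. \<Sum>k\<in>UNIV. A * w j b k * (Z * Y))"
    by (intro sum_mono termwise) auto
  also have "\<dots> \<le> (\<Sum>j\<in>UNIV. \<Sum>b\<in>-C. \<Sum>k\<in>UNIV. A * w j b k * (Z * Y))"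
    using w YZ \<open>0 \<le> A\<close> by (intro sum_mono2) (auto intro!: sum_nonneg)
  also have "\<dots> \<le> (\<Sum>j\<in>UNIV. \<Sum>b\<in>UNIV. \<Sum>k\<in>UNIV. A * w j b k * (Z * Y))"
    using w YZ \<open>0 \<le> A\<close> by (intro sum_mono sum_mono2) (auto intro!: sum_nonneg)
  finally show ?thesis by (simp only: sum_distrib_left sum_distrib_right)
qed

lemma affine_le_geometric:
  fixes \<alpha> \<beta> \<rho> :: real
  assumes "1 < \<rho>"
  obtains k0 where "\<And>k. k0 \<le> k \<Longrightarrow> \<alpha> + \<beta> * (2 * real k + 1) \<le> \<rho> ^ k"
proof -
  have "(\<lambda>k. real k * (1 / \<rho>) ^ k) \<longlonglongrightarrow> 0"
    using assms by (intro powser_times_n_limit_0) simp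
  moreover have "(\<lambda>k. (1 / \<rho>) ^ k) \<longlonglongrightarrow> 0"
    using assms by (intro LIMSEQ_realpow_zero) auto
  ultimately have "(\<lambda>k. (\<alpha> + \<beta>) * (1 / \<rho>) ^ k + 2 * \<beta> * (real k * (1 / \<rho>) ^ k))
      \<longlonglongrightarrow> (\<alpha> + \<beta>) * 0 + 2 * \<beta> * 0"
    by (intro tendsto_add tendsto_mult_left)
  then have "\<forall>\<^sub>F k in sequentially. (\<alpha> + \<beta>) * (1 / \<rho>) ^ k + 2 * \<beta> * (real k * (1 / \<rho>) ^ k) < 1"
    by (rule order_tendstoD) simp
  then obtain k0 where k0: "\<And>k. k0 \<le> k
      \<Longrightarrow> (\<alpha> + \<beta>) * (1 / \<rho>) ^ k + 2 * \<beta> * (real k * (1 / \<rho>) ^ k) < 1"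
    unfolding eventually_sequentially by blast
  show thesis
  proof (rule that[of k0])
    fix k assume "k0 \<le> k"
    have "(\<alpha> + \<beta> * (2 * real k + 1)) / \<rho> ^ k
        = (\<alpha> + \<beta>) * (1 / \<rho>) ^ k + 2 * \<beta> * (real k * (1 / \<rho>) ^ k)"
      by (simp add: power_inverse divide_inverse algebra_simps)
    also have "\<dots> < 1" by (rule k0[OF \<open>k0 \<le> k\<close>])
    finally have "(\<alpha> + \<beta> * (2 * real k + 1)) / \<rho> ^ k < 1" .
    then show "\<alpha> + \<beta> * (2 * real k + 1) \<le> \<rho> ^ k" using assms by (simp add: divide_simps)
  qed
qed

section \<open>Patterns as nonnegative linear maps\<close>

locale nonneg_product =
  fixes op :: "real ^ 'd \<Rightarrow> real ^ 'd \<Rightarrow> real ^ 'd" and s :: "real ^ 'd"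
    and c :: "'d \<Rightarrow> 'd \<Rightarrow> 'd \<Rightarrow> real"
  assumes op_nth: "\<And>x y k. op x y $ k = (\<Sum>i\<in>UNIV. \<Sum>j\<in>UNIV. c k i j * x $ i * y $ j)"
    and c_nonneg: "\<And>k i j. 0 \<le> c k i j"
    and s_pos: "\<And>i. 0 < s $ i"
begin

abbreviation "value_of_size n x \<equiv> x \<in> products op s n"

lemma bilinear_op: "bilinear op"
  using op_nth c_nonneg by (intro nonneg_bilinear_imp_bilinear) (auto simp: nonneg_bilinear_def)

lemma linear_op_left: "linear (\<lambda>u. op u z)" and linear_op_right: "linear (\<lambda>u. op z u)"
  using bilinear_op by (auto simp: bilinear_def)

lemma s_nonneg: "0 \<le> s $ i"
  using s_pos by (rule less_imp_le)

lemma op_nonneg: "(\<And>i. 0 \<le> x $ i) \<Longrightarrow> (\<And>i. 0 \<le> y $ i) \<Longrightarrow> 0 \<le> op x y $ i"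
  by (auto simp: op_nth intro!: sum_nonneg mult_nonneg_nonneg c_nonneg)

lemma value_nonneg: "value_of_size n x \<Longrightarrow> 0 \<le> x $ i"
proof (induction arbitrary: i rule: products_induct)
  case generator
  show ?case by (rule s_nonneg)
next
  case (product m k y z)
  show ?case by (rule op_nonneg) (use product in blast)+
qed

lemma op_ge_term:
  assumes "\<And>i. 0 \<le> x $ i" "\<And>i. 0 \<le> y $ i"
  shows "c k i j * x $ i * y $ j \<le> op x y $ k"
proof -
  have "c k i j * x $ i * y $ j \<le> (\<Sum>j\<in>UNIV. c k i j * x $ i * y $ j)"
    by (rule member_le_sum) (auto intro!: mult_nonneg_nonneg c_nonneg assms)
  also have "\<dots> \<le> op x y $ k"
    unfolding op_nth
    by (rule member_le_sum[where f = "\<lambda>i. \<Sum>j\<in>UNIV. c k i j * x $ i * y $ j"])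
      (auto intro!: sum_nonneg mult_nonneg_nonneg c_nonneg assms)
  finally show ?thesis .
qed

text \<open>
  A bracketing of size \<open>n\<close> involves \<open>n\<close> leaves and \<open>n - 1\<close> products, each costing at most a factor
  \<open>K\<close>; so \<open>K ^ (2 * n - 1)\<close> bounds its value, and \<open>H = K ^ 2\<close> will do.
\<close>

lemma value_le_exponential:
  obtains H where "1 \<le> H" "\<And>n x i. value_of_size n x \<Longrightarrow> x $ i \<le> H ^ n"
proof -
  define K where "K = 1 + (\<Sum>i\<in>UNIV. s $ i) + (\<Sum>k\<in>UNIV. \<Sum>i\<in>UNIV. \<Sum>j\<in>UNIV. c k i j)"
  have c_sum: "0 \<le> (\<Sum>k\<in>UNIV. \<Sum>i\<in>UNIV. \<Sum>j\<in>UNIV. c k i j)"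
    by (intro sum_nonneg c_nonneg)
  have s_sum: "0 \<le> (\<Sum>i\<in>UNIV. s $ i)" by (intro sum_nonneg s_nonneg)
  have K1: "1 \<le> K" using c_sum s_sum by (simp add: K_def)
  have sK: "s $ i \<le> K" for i
  proof -
    have "s $ i \<le> (\<Sum>i\<in>UNIV. s $ i)" by (rule member_le_sum) (auto intro: s_nonneg)
    then show ?thesis using c_sum by (simp add: K_def)
  qed
  have cK: "(\<Sum>i\<in>UNIV. \<Sum>j\<in>UNIV. c k i j) \<le> K" for k
  proof -
    have "(\<Sum>i\<in>UNIV. \<Sum>j\<in>UNIV. c k i j) \<le> (\<Sum>k\<in>UNIV. \<Sum>i\<in>UNIV. \<Sum>j\<in>UNIV. c k i j)"
      by (rule member_le_sum[where f = "\<lambda>k. \<Sum>i\<in>UNIV. \<Sum>j\<in>UNIV. c k i j"])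
        (auto intro!: sum_nonneg c_nonneg)
    then show ?thesis using s_sum by (simp add: K_def)
  qed
  have K_bound: "K * x $ i \<le> (K ^ 2) ^ n" if "value_of_size n x" for n x i
    using that
  proof (induction arbitrary: i rule: products_induct)
    case generator
    then show ?case using sK[of i] K1 by (simp add: power2_eq_square)
  next
    case (product m k y z)
    let ?X = "(K ^ 2) ^ m" and ?Y = "(K ^ 2) ^ k"
    have "K * (K * op y z $ i)
      = (\<Sum>a\<in>UNIV. \<Sum>b\<in>UNIV. c i a b * ((K * y $ a) * (K * z $ b)))"
      by (simp add: op_nth sum_distrib_left mult_ac)
    also have "\<dots> \<le> (\<Sum>a\<in>UNIV. \<Sum>b\<in>UNIV. c i a b * (?X * ?Y))"
      using K1 product value_nonneg
      by (intro sum_mono mult_left_mono mult_mono c_nonneg) auto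
    also have "\<dots> = (\<Sum>a\<in>UNIV. \<Sum>b\<in>UNIV. c i a b) * (?X * ?Y)"
      by (simp add: sum_distrib_right)
    also have "\<dots> \<le> K * (?X * ?Y)"
      using cK K1 by (intro mult_right_mono) auto
    finally show ?case using K1 by (simp add: power_add)
  qed
  show thesis
  proof (rule that[of "K ^ 2"])
    show "1 \<le> K ^ 2" using K1 by simp
    show "x $ i \<le> (K ^ 2) ^ n" if "value_of_size n x" for n x i
      using K_bound[OF that, of i] mult_right_mono[OF K1 value_nonneg[OF that, of i]] by simp
  qed
qed

text \<open>
  A linear pattern enters the argument only through its size and the linear map that it induces. Reading
  the path from the root to the marked leaf, this map is a composition of multiplications by fixed
  bracketings, and this description makes composition of patterns available without
  any manipulation of trees.
\<close>

inductive pattern_map :: "nat \<Rightarrow> (real ^ 'd \<Rightarrow> real ^ 'd) \<Rightarrow> bool" where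
  hole: "pattern_map 0 (\<lambda>u. u)"
| left: "pattern_map m f \<Longrightarrow> value_of_size k x \<Longrightarrow> pattern_map (m + k) (\<lambda>u. op (f u) x)"
| right: "pattern_map m f \<Longrightarrow> value_of_size k x \<Longrightarrow> pattern_map (m + k) (\<lambda>u. op x (f u))"

lemma pattern_val_is_pattern_map:
  assumes "p \<in> leaves T"
  shows "pattern_map (pattern_size (T, p)) (pattern_val op s (T, p))"
  using assms
proof (induction T arbitrary: p)
  case Leaf
  have "pattern_val op s (Leaf, []) = (\<lambda>u. u)" by auto
  then show ?case using Leaf pattern_map.hole by simp
next
  case (Node l r)
  obtain a b where ab: "a \<in> leaves l" "b \<in> leaves r" using leaves_nonempty by blast
  from Node.prems consider q where "p = Lft # q" "q \<in> leaves l"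
    | q where "p = Rgt # q" "q \<in> leaves r" by auto
  then show ?case
  proof cases
    case 1
    show ?thesis
      unfolding 1(1) pattern_val_Node pattern_size_Node(1)[OF 1(2) ab(2)]
      by (rule pattern_map.left[OF Node.IH(1)[OF 1(2)] tree_val_in_products])
  next
    case 2
    show ?thesis
      unfolding 2(1) pattern_val_Node pattern_size_Node(2)[OF ab(1) 2(2)]
      by (rule pattern_map.right[OF Node.IH(2)[OF 2(2)] tree_val_in_products])
  qed
qed

lemma pattern_map_is_pattern_val:
  assumes "pattern_map m f"
  shows "\<exists>P\<in>linear_patterns. pattern_size P = m \<and> pattern_val op s P = f"
  using assms
proof induction
  case hole
  have "pattern_val op s (Leaf, []) = (\<lambda>u. u)" by auto
  then show ?case
    by (intro bexI[of _ "(Leaf, [])"]) (auto simp: linear_patterns_def)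
next
  case (left m f k x)
  then obtain l p where P: "p \<in> leaves l" "pattern_size (l, p) = m" "pattern_val op s (l, p) = f"
    by (auto simp: linear_patterns_def)
  obtain r where r: "card (leaves r) = k" "tree_val op (\<lambda>_. s) r = x"
    using products_imp_tree[OF left(2)] by blast
  obtain q where "q \<in> leaves r" using leaves_nonempty by blast
  then show ?case
    using P r pattern_size_Node(1)[of p l q r] pattern_val_Node(1)[of op s l r p]
    by (intro bexI[of _ "(Node l r, Lft # p)"]) (auto simp: linear_patterns_def)
next
  case (right m f k x)
  then obtain r p where P: "p \<in> leaves r" "pattern_size (r, p) = m" "pattern_val op s (r, p) = f"
    by (auto simp: linear_patterns_def)
  obtain l where l: "card (leaves l) = k" "tree_val op (\<lambda>_. s) l = x"
    using products_imp_tree[OF right(2)] by blast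
  obtain q where "q \<in> leaves l" using leaves_nonempty by blast
  then show ?case
    using P l pattern_size_Node(2)[of q l p r] pattern_val_Node(2)[of op s l r p]
    by (intro bexI[of _ "(Node l r, Rgt # p)"]) (auto simp: linear_patterns_def)
qed

lemma pattern_map_linear: "pattern_map m f \<Longrightarrow> linear f"
proof (induction rule: pattern_map.induct)
  case hole
  then show ?case by (simp add: linear_id[unfolded id_def])
next
  case (left m f k x)
  then show ?case using linear_compose[OF _ linear_op_left[of x], of f] by (simp add: o_def)
next
  case (right m f k x)
  then show ?case using linear_compose[OF _ linear_op_right[of x], of f] by (simp add: o_def)
qed

lemma pattern_map_value: "pattern_map m f \<Longrightarrow> value_of_size n x \<Longrightarrow> value_of_size (m + n) (f x)"
proof (induction rule: pattern_map.induct)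
  case (left m f k y)
  then show ?case using products_op[of "f x" op s "m + n" y k] by (simp add: ac_simps)
next
  case (right m f k y)
  then show ?case using products_op[of y op s k "f x" "m + n"] by (simp add: ac_simps)
qed simp

lemma pattern_map_comp: "pattern_map m f \<Longrightarrow> pattern_map n g \<Longrightarrow> pattern_map (m + n) (f \<circ> g)"
proof (induction rule: pattern_map.induct)
  case (left m f k x)
  then show ?case
    using pattern_map.left[where m = "m + n" and f = "f \<circ> g" and k = k and x = x] by (simp add: o_def ac_simps)
next
  case (right m f k x)
  then show ?case
    using pattern_map.right[where m = "m + n" and f = "f \<circ> g" and k = k and x = x] by (simp add: o_def ac_simps)
qed (simp add: o_def)

lemma pattern_map_op:
  assumes "value_of_size k x"
  shows "pattern_map k (\<lambda>u. op u x)" "pattern_map k (\<lambda>u. op x u)"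
  using pattern_map.left[OF hole assms] pattern_map.right[OF hole assms] by simp_all

lemma pattern_map_nonneg: "pattern_map m f \<Longrightarrow> (\<And>i. 0 \<le> u $ i) \<Longrightarrow> 0 \<le> f u $ i"
proof (induction arbitrary: i rule: pattern_map.induct)
  case (left m f k x)
  show ?case by (rule op_nonneg) (use left value_nonneg in blast)+
next
  case (right m f k x)
  show ?case by (rule op_nonneg) (use right value_nonneg in blast)+
qed simp

lemma matrix_nonneg: "pattern_map m f \<Longrightarrow> 0 \<le> matrix f $ i $ j"
  by (auto simp: matrix_def axis_def intro: pattern_map_nonneg)

lemma pattern_map_nth:
  assumes "pattern_map m f"
  shows "f u $ i = (\<Sum>j\<in>UNIV. matrix f $ i $ j * u $ j)"
proof -
  have "f u = matrix f *v u" using pattern_map_linear[OF assms] by (simp add: matrix_works)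
  then show ?thesis by (simp add: matrix_vector_mult_def)
qed

lemma matrix_comp_nth:
  assumes "pattern_map m f" "pattern_map n g"
  shows "matrix (f \<circ> g) $ i $ j = (\<Sum>k\<in>UNIV. matrix f $ i $ k * matrix g $ k $ j)"
  using pattern_map_nth[OF assms(1), of "g (axis j 1)" i] by (simp add: matrix_def)

lemma matrix_comp_ge:
  assumes "pattern_map m f" "pattern_map n g"
  shows "matrix f $ i $ k * matrix g $ k $ j \<le> matrix (f \<circ> g) $ i $ j"
  unfolding matrix_comp_nth[OF assms]
  by (rule member_le_sum) (auto intro!: mult_nonneg_nonneg matrix_nonneg assms)

lemma pattern_map_ge_term:
  assumes "pattern_map m f" "\<And>i. 0 \<le> u $ i"
  shows "matrix f $ i $ j * u $ j \<le> f u $ i"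
  unfolding pattern_map_nth[OF assms(1)]
  by (rule member_le_sum) (auto intro!: mult_nonneg_nonneg matrix_nonneg assms)

lemma matrix_id_nth: "matrix (\<lambda>u::real ^ 'd. u) $ i $ j = (if i = j then 1 else 0)"
  by (simp add: matrix_def axis_def)

lemma sum_times_axis: "(\<Sum>a\<in>UNIV. h a * axis b (1::real) $ a) = h (b :: 'd)"
  by (simp add: axis_def if_distrib cong: if_cong)

lemma matrix_op_nth:
  "matrix (\<lambda>u. op u z) $ j $ b = (\<Sum>k\<in>UNIV. c j b k * z $ k)"
  "matrix (\<lambda>u. op z u) $ j $ b = (\<Sum>k\<in>UNIV. c j k b * z $ k)"
proof -
  have "op (axis b 1) z $ j = (\<Sum>a\<in>UNIV. (\<Sum>k\<in>UNIV. c j a k * z $ k) * axis b 1 $ a)"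
    unfolding op_nth sum_distrib_right by (simp add: mult_ac)
  then show "matrix (\<lambda>u. op u z) $ j $ b = (\<Sum>k\<in>UNIV. c j b k * z $ k)"
    by (simp add: matrix_def sum_times_axis)
  have "op z (axis b 1) $ j = (\<Sum>k\<in>UNIV. \<Sum>a\<in>UNIV. (c j k a * z $ k) * axis b 1 $ a)"
    by (simp add: op_nth)
  then show "matrix (\<lambda>u. op z u) $ j $ b = (\<Sum>k\<in>UNIV. c j k b * z $ k)"
    by (simp add: matrix_def sum_times_axis)
qed

section \<open>The lower bound\<close>

text \<open>Both kinds of outermost product are presented as one composition, so that arguments about the
  top of a pattern need no case distinction between left and right.\<close>

lemma pattern_map_outermost:
  assumes "pattern_map m f" "1 \<le> m"
  obtains m' g k h x where "m = m' + k" "pattern_map m' g" "value_of_size k x" "f = h \<circ> g"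
    "h = (\<lambda>u. op u x) \<or> h = (\<lambda>u. op x u)"
  using assms
proof cases
  case (left m' g k x)
  then show ?thesis using that[of m' k g x "\<lambda>u. op u x"] by (simp add: o_def)
next
  case (right m' g k x)
  then show ?thesis using that[of m' k g x "\<lambda>u. op x u"] by (simp add: o_def)
qed simp

definition recurrent :: "'d \<Rightarrow> bool" where
  "recurrent i \<longleftrightarrow> (\<exists>m f. pattern_map m f \<and> 1 \<le> m \<and> 0 < matrix f $ i $ i)"

text \<open>
  Split the pattern as \<open>h \<circ> g\<close> with \<open>h\<close> a single product at the root. Positivity of the diagonal entry
  at \<open>i\<close> gives an intermediate index \<open>b\<close>, and rotating the cycle, that is passing to \<open>g \<circ> h\<close>,
  gives a positive diagonal entry at \<open>b\<close>.
\<close>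

lemma recurrent_successor:
  assumes "recurrent i"
  shows "\<exists>b k. recurrent b \<and> (0 < c i b k \<or> 0 < c i k b)"
proof -
  obtain m f where f: "pattern_map m f" "1 \<le> m" "0 < matrix f $ i $ i"
    using assms unfolding recurrent_def by blast
  obtain m' g k h x where g: "m = m' + k" "pattern_map m' g" "value_of_size k x" "f = h \<circ> g"
    "h = (\<lambda>u. op u x) \<or> h = (\<lambda>u. op x u)"
    using pattern_map_outermost[OF f(1,2)] by metis
  have h: "pattern_map k h" using g(3,5) pattern_map_op by blast
  have "0 < (\<Sum>b\<in>UNIV. matrix h $ i $ b * matrix g $ b $ i)"
    using f(3) matrix_comp_nth[OF h g(2)] g(4) by simp
  then have "\<not> (\<forall>b. matrix h $ i $ b * matrix g $ b $ i \<le> 0)"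
    by (meson sum_nonpos not_less)
  then obtain b where "0 < matrix h $ i $ b * matrix g $ b $ i" by (auto simp: not_le)
  then have b: "0 < matrix h $ i $ b" "0 < matrix g $ b $ i"
    using matrix_nonneg[OF h, of i b] matrix_nonneg[OF g(2), of b i]
    by (auto simp: zero_less_mult_iff)
  have "0 < matrix g $ b $ i * matrix h $ i $ b" using b by simp
  also have "\<dots> \<le> matrix (g \<circ> h) $ b $ b" by (rule matrix_comp_ge[OF g(2) h])
  finally have "recurrent b"
    unfolding recurrent_def using pattern_map_comp[OF g(2) h] g(1) f(2) by blast
  moreover have "\<exists>k. 0 < c i b k \<or> 0 < c i k b"
  proof (rule ccontr)
    assume "\<not> ?thesis"
    then have "c i b k = 0" "c i k b = 0" for k using c_nonneg by (meson antisym not_less)+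
    then show False using g(5) b(1) by (auto simp: matrix_op_nth)
  qed
  ultimately show ?thesis by blast
qed

text \<open>
  Walking along successors yields a comb all of whose side branches are the single leaf \<open>s\<close>. Since
  \<open>s\<close> is positive everywhere, the walk may be cut off after any number of steps.
\<close>

lemma recurrent_positive_value:
  assumes "1 \<le> n" "recurrent i"
  shows "\<exists>y. value_of_size n y \<and> 0 < y $ i"
  using assms
proof (induction n arbitrary: i rule: dec_induct)
  case base
  show ?case by (intro exI[of _ s] conjI products_generator s_pos)
next
  case (step n)
  obtain b k where b: "recurrent b" and k: "0 < c i b k \<or> 0 < c i k b"
    using recurrent_successor[OF step.prems] by blast
  obtain y where y: "value_of_size n y" "0 < y $ b" using step.IH[OF b] by blast
  have nn: "\<And>i. 0 \<le> y $ i" "\<And>i. 0 \<le> s $ i"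
    using value_nonneg[OF y(1)] s_nonneg by auto
  have "value_of_size (Suc n) (op y s)" "value_of_size (Suc n) (op s y)"
    using products_op[OF y(1) products_generator] products_op[OF products_generator y(1)] by simp_all
  moreover have "0 < op y s $ i \<or> 0 < op s y $ i"
    using k
  proof
    assume "0 < c i b k"
    then have "0 < c i b k * y $ b * s $ k" using y(2) s_pos by simp
    then show ?thesis using op_ge_term[OF nn, of i b k] by simp
  next
    assume "0 < c i k b"
    then have "0 < c i k b * s $ k * y $ b" using y(2) s_pos by simp
    then show ?thesis using op_ge_term[OF nn(2,1), of i k b] by simp
  qed
  ultimately show ?case by blast
qed

lemma pattern_map_funpow: "pattern_map m f \<Longrightarrow> pattern_map (k * m) (f ^^ k)"
  by (induction k) (auto simp: id_def o_def intro: hole dest: pattern_map_comp)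

lemma funpow_ge:
  assumes "pattern_map m f" "\<And>i. 0 \<le> u $ i"
  shows "(matrix f $ i $ i) ^ k * u $ i \<le> (f ^^ k) u $ i"
proof (induction k)
  case (Suc k)
  have "\<And>j. 0 \<le> (f ^^ k) u $ j"
    using pattern_map_nonneg[OF pattern_map_funpow[OF assms(1)] assms(2)] by blast
  then have "matrix f $ i $ i * (f ^^ k) u $ i \<le> f ((f ^^ k) u) $ i"
    by (rule pattern_map_ge_term[OF assms(1)])
  then show ?case
    using mult_left_mono[OF Suc matrix_nonneg[OF assms(1), of i i]] by (simp add: mult.assoc)
qed simp

text \<open>
  Writing \<open>n = q * m + r\<close> with \<open>1 \<le> r \<le> m\<close>, the pattern is applied \<open>q\<close> times to a bracketing of size
  \<open>r\<close> that is positive at \<open>i\<close>; only finitely many such starting values occur, so a single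
  constant \<open>\<kappa>\<close> covers them.
\<close>

lemma values_ge_geometric:
  assumes "pattern_map m f" "1 \<le> m" "0 < a" "matrix f $ i $ i = a ^ m"
  shows "\<exists>\<kappa>>0. \<forall>n\<ge>1. \<exists>x. value_of_size n x \<and> \<kappa> * a ^ n \<le> x $ i"
proof -
  have rec: "recurrent i"
    unfolding recurrent_def using assms by (metis zero_less_power)
  obtain y where y: "\<And>r. 1 \<le> r \<Longrightarrow> value_of_size r (y r) \<and> 0 < y r $ i"
    using recurrent_positive_value[OF _ rec] by metis
  define \<kappa> where "\<kappa> = Min ((\<lambda>r. y r $ i / a ^ r) ` {1..m})"
  have "{1..m} \<noteq> {}" using assms(2) by simp
  then have "0 < \<kappa>" unfolding \<kappa>_def using y assms(3) by (subst Min_gr_iff) auto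
  moreover have "\<exists>x. value_of_size n x \<and> \<kappa> * a ^ n \<le> x $ i" if "1 \<le> n" for n
  proof -
    \<comment> \<open>The shift by one puts the remainder into \<open>{1..m}\<close>: there is no bracketing of size \<open>0\<close>.\<close>
    define q r where "q = (n - 1) div m" and "r = (n - 1) mod m + 1"
    have r: "r \<in> {1..m}" using assms(2) by (auto simp: r_def Suc_leI)
    have n: "n = q * m + r" using that by (simp add: q_def r_def)
    have "\<kappa> \<le> y r $ i / a ^ r" unfolding \<kappa>_def using r by (intro Min_le) auto
    then have "\<kappa> * a ^ r \<le> y r $ i" using assms(3) by (simp add: field_simps)
    then have "(a ^ m) ^ q * (\<kappa> * a ^ r) \<le> (a ^ m) ^ q * y r $ i"
      using assms(3) by (intro mult_left_mono) auto
    also have "\<dots> \<le> (f ^^ q) (y r) $ i"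
      using funpow_ge[OF assms(1), of "y r" i q] y[of r] r value_nonneg assms(4) by auto
    finally have "\<kappa> * a ^ n \<le> (f ^^ q) (y r) $ i"
      by (simp add: n power_add mult_ac flip: power_mult)
    moreover have "value_of_size n ((f ^^ q) (y r))"
      unfolding n using pattern_map_value[OF pattern_map_funpow[OF assms(1)]] y r by auto
    ultimately show ?thesis by blast
  qed
  ultimately show ?thesis by blast
qed

section \<open>Strongly connected components\<close>

text \<open>
  Reachability is expressed by patterns of any size, the bare hole included, rather than by paths of
  nonzero coefficients: reflexivity comes from the hole and transitivity from composition of patterns.
\<close>

definition reaches :: "'d \<Rightarrow> 'd \<Rightarrow> bool" where
  "reaches i j \<longleftrightarrow> (\<exists>m f. pattern_map m f \<and> 0 < matrix f $ i $ j)"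

lemma reaches_refl: "reaches i i"
  unfolding reaches_def using hole matrix_id_nth[of i i] by fastforce

lemma reaches_trans:
  assumes "reaches i j" "reaches j k"
  shows "reaches i k"
proof -
  obtain m f n g where f: "pattern_map m f" "0 < matrix f $ i $ j"
    and g: "pattern_map n g" "0 < matrix g $ j $ k"
    using assms unfolding reaches_def by blast
  have "0 < matrix f $ i $ j * matrix g $ j $ k" using f g by simp
  also have "\<dots> \<le> matrix (f \<circ> g) $ i $ k" by (rule matrix_comp_ge[OF f(1) g(1)])
  finally show ?thesis unfolding reaches_def using pattern_map_comp[OF f(1) g(1)] by blast
qed

lemma coeff_reaches:
  assumes "0 < c j b k"
  shows "reaches j b" "reaches j k"
proof -
  have "value_of_size 1 s" by (rule products_generator)
  note maps = pattern_map_op[OF this]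
  have "c j b k * s $ k \<le> (\<Sum>k\<in>UNIV. c j b k * s $ k)"
    by (rule member_le_sum[where f = "\<lambda>k. c j b k * s $ k"])
      (auto intro!: mult_nonneg_nonneg c_nonneg s_nonneg)
  moreover have "0 < c j b k * s $ k" using assms s_pos by simp
  ultimately have "0 < matrix (\<lambda>u. op u s) $ j $ b" by (simp add: matrix_op_nth)
  then show "reaches j b" using maps(1) unfolding reaches_def by blast
  have "c j b k * s $ b \<le> (\<Sum>b\<in>UNIV. c j b k * s $ b)"
    by (rule member_le_sum[where f = "\<lambda>b. c j b k * s $ b"])
      (auto intro!: mult_nonneg_nonneg c_nonneg s_nonneg)
  moreover have "0 < c j b k * s $ b" using assms s_pos by simp
  ultimately have "0 < matrix (\<lambda>u. op s u) $ j $ k" by (simp add: matrix_op_nth)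
  then show "reaches j k" using maps(2) unfolding reaches_def by blast
qed

text \<open>
  Composing with a fixed pattern \<open>g\<close> from \<open>j\<close> back to \<open>i\<close> turns the entry at \<open>(i, j)\<close> into a summand
  of a diagonal entry.
\<close>

lemma component_entry_bound:
  assumes diag: "\<And>m f i. pattern_map m f \<Longrightarrow> matrix f $ i $ i \<le> \<mu> ^ m" and "0 < \<mu>"
    and "reaches j i"
  shows "\<exists>K. \<forall>m f. pattern_map m f \<longrightarrow> matrix f $ i $ j \<le> K * \<mu> ^ m"
proof -
  obtain q g where g: "pattern_map q g" "0 < matrix g $ j $ i"
    using assms(3) unfolding reaches_def by blast
  have "matrix f $ i $ j \<le> \<mu> ^ q / matrix g $ j $ i * \<mu> ^ m" if "pattern_map m f" for m f
  proof -
    have "matrix f $ i $ j * matrix g $ j $ i \<le> matrix (f \<circ> g) $ i $ i"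
      by (rule matrix_comp_ge[OF that g(1)])
    also have "\<dots> \<le> \<mu> ^ (m + q)" by (rule diag[OF pattern_map_comp[OF that g(1)]])
    finally show ?thesis using g(2) by (simp add: field_simps power_add)
  qed
  then show ?thesis by blast
qed

text \<open>
  One step of the expansion along a path: \<open>f\<close> is the part of the path already traversed and \<open>g\<close> the next
  product. The walks that stay in \<open>C\<close> are absorbed into the longer pattern \<open>f \<circ> g\<close>, those that leave \<open>C\<close>
  at this step remain as an explicit error.
\<close>

lemma sum_split_at_component:
  assumes "pattern_map m f" "pattern_map n g" "\<And>b. 0 \<le> y $ b"
  shows "(\<Sum>j\<in>C. matrix f $ i $ j * g y $ j)
    \<le> (\<Sum>b\<in>C. matrix (f \<circ> g) $ i $ b * y $ b)
      + (\<Sum>j\<in>C. \<Sum>b\<in>-C. matrix f $ i $ j * (matrix g $ j $ b * y $ b))"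
proof -
  let ?t = "\<lambda>j b. matrix f $ i $ j * (matrix g $ j $ b * y $ b)"
  have split: "(\<Sum>b\<in>UNIV. ?t j b) = (\<Sum>b\<in>C. ?t j b) + (\<Sum>b\<in>-C. ?t j b)" for j
    using sum.union_disjoint[of C "-C" "?t j"] by simp
  have "(\<Sum>j\<in>C. matrix f $ i $ j * g y $ j)
      = (\<Sum>j\<in>C. \<Sum>b\<in>C. ?t j b) + (\<Sum>j\<in>C. \<Sum>b\<in>-C. ?t j b)"
    by (simp add: pattern_map_nth[OF assms(2)] sum_distrib_left split flip: sum.distrib)
  also have "(\<Sum>j\<in>C. \<Sum>b\<in>C. ?t j b)
      = (\<Sum>b\<in>C. (\<Sum>j\<in>C. matrix f $ i $ j * matrix g $ j $ b) * y $ b)"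
    by (subst sum.swap) (simp add: sum_distrib_right mult.assoc)
  also have "\<dots> \<le> (\<Sum>b\<in>C. matrix (f \<circ> g) $ i $ b * y $ b)"
    unfolding matrix_comp_nth[OF assms(1,2)]
    by (intro sum_mono mult_right_mono sum_mono2 assms(3))
      (auto intro!: mult_nonneg_nonneg matrix_nonneg assms)
  finally show ?thesis by simp
qed

section \<open>The upper bound\<close>

definition coeff_sum :: real where
  "coeff_sum = (\<Sum>j\<in>UNIV. \<Sum>b\<in>UNIV. \<Sum>k\<in>UNIV. c j b k)"

lemma coeff_sum_nonneg: "0 \<le> coeff_sum"
  unfolding coeff_sum_def by (intro sum_nonneg c_nonneg)

text \<open>
  Descending into the larger factor, \<open>sum_split_at_component\<close> is applied once for every product on the path.
  Each product contributes walks that leave \<open>C\<close> there; their weight is a product of an entry within \<open>C\<close>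
  (constant \<open>K\<close>), the value of the larger factor at an index outside \<open>C\<close> (constant \<open>E\<close>) and the
  value of the smaller factor, which has at most \<open>N / 2\<close> leaves (constant \<open>B\<close>). There are fewer than
  \<open>n\<close> products on the path, whence the factor \<open>n\<close>. The remaining term, with the sum of the entries
  of \<open>s\<close>, comes from the walks that are still in \<open>C\<close> at the leaf where the path ends. The constant
  \<open>B\<close> occurs only to the first power, because a walk leaves \<open>C\<close> at most once.
\<close>

lemma heavy_path_descent:
  assumes "0 < \<mu>" "0 \<le> K" "0 \<le> E" "0 \<le> B"
    and entry: "\<And>m f j. pattern_map m f \<Longrightarrow> j \<in> C \<Longrightarrow> matrix f $ i $ j \<le> K * \<mu> ^ m"
    and light: "\<And>k z b. value_of_size k z \<Longrightarrow> 2 * k \<le> N \<Longrightarrow> b \<in> R \<Longrightarrow> z $ b \<le> B * \<mu> ^ k"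
    and escape: "\<And>k y b. value_of_size k y \<Longrightarrow> b \<in> R - C \<Longrightarrow> y $ b \<le> E * \<mu> ^ k"
    and closed: "\<And>j b k. j \<in> C \<Longrightarrow> 0 < c j b k \<Longrightarrow> b \<in> R \<and> k \<in> R"
    and x: "value_of_size n x" "n \<le> N" "pattern_map m f"
  shows "(\<Sum>j\<in>C. matrix f $ i $ j * x $ j)
    \<le> K * ((\<Sum>j\<in>UNIV. s $ j) / \<mu> + real n * (coeff_sum * (B * E))) * \<mu> ^ (m + n)"
proof -
  define bd where
    "bd n = K * ((\<Sum>j\<in>UNIV. s $ j) / \<mu> + real n * (coeff_sum * (B * E)))" for n :: nat
  \<comment> \<open>\<open>y\<close> is the larger factor, \<open>z\<close> the smaller one, and \<open>h\<close> multiplication by \<open>z\<close> on either side; the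
    array \<open>w\<close> is \<open>c\<close> or its transpose accordingly.\<close>
  have step: "(\<Sum>j\<in>C. matrix f $ i $ j * h y $ j) \<le> bd (p + q) * \<mu> ^ (m + (p + q))"
    if f: "pattern_map m f" and h: "pattern_map q h"
      and y: "value_of_size p y" and z: "value_of_size q z" and pq: "p + q \<le> N" "q \<le> p"
      and IH: "\<And>m f. pattern_map m f
        \<Longrightarrow> (\<Sum>j\<in>C. matrix f $ i $ j * y $ j) \<le> bd p * \<mu> ^ (m + p)"
      and W: "\<And>j b. matrix h $ j $ b = (\<Sum>k\<in>UNIV. w j b k * z $ k)"
      and w: "\<And>j b k. 0 \<le> w j b k" "\<And>j b k. j \<in> C \<Longrightarrow> 0 < w j b k \<Longrightarrow> b \<in> R \<and> k \<in> R"
        "(\<Sum>j\<in>UNIV. \<Sum>b\<in>UNIV. \<Sum>k\<in>UNIV. w j b k) = coeff_sum"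
    for m f h y z p q and w :: "'d \<Rightarrow> 'd \<Rightarrow> 'd \<Rightarrow> real"
  proof -
    have "(\<Sum>j\<in>C. matrix f $ i $ j * h y $ j)
        \<le> (\<Sum>b\<in>C. matrix (f \<circ> h) $ i $ b * y $ b)
          + (\<Sum>j\<in>C. \<Sum>b\<in>-C. matrix f $ i $ j * (matrix h $ j $ b * y $ b))"
      by (rule sum_split_at_component[OF f h value_nonneg[OF y]])
    also have "(\<Sum>b\<in>C. matrix (f \<circ> h) $ i $ b * y $ b) \<le> bd p * \<mu> ^ (m + q + p)"
      by (rule IH[OF pattern_map_comp[OF f h]])
    also have "(\<Sum>j\<in>C. \<Sum>b\<in>-C. matrix f $ i $ j * (matrix h $ j $ b * y $ b))
        \<le> K * \<mu> ^ m * coeff_sum * (B * \<mu> ^ q * (E * \<mu> ^ p))"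
      unfolding W w(3)[symmetric]
    proof (rule leak_bound)
      fix j b k assume "j \<in> C" "b \<notin> C" "0 < w j b k"
      then have "b \<in> R - C" "k \<in> R" using w(2) by auto
      then show "y $ b \<le> E * \<mu> ^ p \<and> z $ k \<le> B * \<mu> ^ q"
        using escape[OF y] light[OF z] pq by auto
    qed (use assms(1-4) f y z w(1) entry value_nonneg matrix_nonneg in auto)
    also have "bd p * \<mu> ^ (m + q + p) + K * \<mu> ^ m * coeff_sum * (B * \<mu> ^ q * (E * \<mu> ^ p))
        = bd (p + 1) * \<mu> ^ (m + (p + q))"
      by (simp add: bd_def power_add algebra_simps)
    also have "\<dots> \<le> bd (p + q) * \<mu> ^ (m + (p + q))"
      using products_size_pos[OF z] assms(1-4) coeff_sum_nonneg unfolding bd_def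
      by (intro mult_right_mono mult_left_mono add_left_mono) auto
    finally show ?thesis by simp
  qed
  have "(\<Sum>j\<in>C. matrix f $ i $ j * x $ j) \<le> bd n * \<mu> ^ (m + n)"
    using x
  proof (induction arbitrary: m f rule: products_induct)
    case generator
    have "(\<Sum>j\<in>C. matrix f $ i $ j * s $ j) \<le> (\<Sum>j\<in>C. K * \<mu> ^ m * s $ j)"
      using entry[OF generator(2)] by (intro sum_mono mult_right_mono) (auto intro: s_nonneg)
    also have "\<dots> \<le> (\<Sum>j\<in>UNIV. K * \<mu> ^ m * s $ j)"
      using assms(1,2) s_nonneg by (intro sum_mono2) auto
    also have "\<dots> = K * \<mu> ^ m * (\<Sum>j\<in>UNIV. s $ j)" by (simp only: sum_distrib_left)
    also have "\<dots> = K * ((\<Sum>j\<in>UNIV. s $ j) / \<mu>) * \<mu> ^ (m + 1)"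
      using assms(1) by simp
    also have "\<dots> \<le> bd 1 * \<mu> ^ (m + 1)"
      unfolding bd_def using assms(1-4) coeff_sum_nonneg
      by (intro mult_right_mono mult_left_mono) auto
    finally show ?case .
  next
    case (product p q y z)
    have swap: "(\<Sum>j\<in>UNIV. \<Sum>b\<in>UNIV. \<Sum>k\<in>UNIV. c j k b) = coeff_sum"
      unfolding coeff_sum_def by (intro sum.cong sum.swap refl)
    show ?case
    proof (cases "q \<le> p")
      case True
      show ?thesis
      proof (rule step[where w = c and h = "\<lambda>u. op u z" and y = y and z = z])
        show "pattern_map q (\<lambda>u. op u z)" by (rule pattern_map_op(1)[OF product(2)])
        show "\<And>m f. pattern_map m f
            \<Longrightarrow> (\<Sum>j\<in>C. matrix f $ i $ j * y $ j) \<le> bd p * \<mu> ^ (m + p)"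
          using product(3,5) by simp
      qed (use True product closed c_nonneg in \<open>auto simp: matrix_op_nth coeff_sum_def\<close>)
    next
      case False
      have "(\<Sum>j\<in>C. matrix f $ i $ j * op y z $ j) \<le> bd (q + p) * \<mu> ^ (m + (q + p))"
      proof (rule step[where w = "\<lambda>j b k. c j k b" and h = "\<lambda>u. op y u" and y = z and z = y])
        show "pattern_map p (\<lambda>u. op y u)" by (rule pattern_map_op(2)[OF product(1)])
        show "\<And>m f. pattern_map m f
            \<Longrightarrow> (\<Sum>j\<in>C. matrix f $ i $ j * z $ j) \<le> bd q * \<mu> ^ (m + q)"
          using product(4,5) by simp
      qed (use False product closed c_nonneg swap in \<open>auto simp: matrix_op_nth(2)[of y]\<close>)
      then show ?thesis by (simp add: ac_simps)
    qed
  qed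
  then show ?thesis by (simp only: bd_def)
qed

text \<open>
  Induction on the number of indices that \<open>i\<close> reaches. The rate must be allowed to vary in the induction:
  the indices outside the component \<open>C\<close> of \<open>i\<close>, and the entries within it, are used at a rate \<open>\<mu>\<close>
  strictly between \<open>\<theta>\<close> and \<open>\<nu>\<close>. With \<open>\<rho> = \<nu> / \<mu>\<close>, a bound \<open>L * \<nu> ^ k\<close> for sizes
  \<open>k \<le> n / 2\<close> is a bound \<open>L * \<rho> ^ (n div 2) * \<mu> ^ k\<close>, and the descent turns this
  into a bound at size \<open>n\<close> in which \<open>\<rho> ^ (n div 2)\<close> is multiplied by an affine function of \<open>n\<close>.
  For large \<open>n\<close> the remaining half of \<open>\<rho> ^ n\<close> pays for the affine factor.
\<close>

lemma value_bound_above_diagonal_rate: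
  assumes diag: "\<And>m f i. pattern_map m f \<Longrightarrow> matrix f $ i $ i \<le> \<theta> ^ m"
    and "0 \<le> \<theta>" "\<theta> < \<nu>"
  shows "\<exists>K. \<forall>n x. value_of_size n x \<longrightarrow> x $ i \<le> K * \<nu> ^ n"
  using assms(3)
proof (induction "card {j. reaches i j}" arbitrary: i \<nu> rule: less_induct)
  case less
  define R C \<mu> \<rho> where "R = {j. reaches i j}" and "C = {j. reaches i j \<and> reaches j i}"
    and "\<mu> = (\<theta> + \<nu>) / 2" and "\<rho> = \<nu> / \<mu>"
  have \<mu>: "0 < \<mu>" "\<theta> < \<mu>" "\<mu> < \<nu>" using less.prems assms(2) by (auto simp: \<mu>_def)
  then have \<rho>: "1 < \<rho>" and \<nu>: "\<nu> = \<rho> * \<mu>" "0 < \<nu>" by (auto simp: \<rho>_def)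
  have diag_\<mu>: "matrix f $ a $ a \<le> \<mu> ^ m" if "pattern_map m f" for m f a
    using diag[OF that, of a] power_mono[of \<theta> \<mu> m] \<mu> assms(2) by simp
  have "\<exists>K\<ge>1. \<forall>p\<in>C \<times> C. \<forall>m f. pattern_map m f \<longrightarrow> matrix f $ fst p $ snd p \<le> K * \<mu> ^ m"
  proof (rule uniform_constant[where h = "\<lambda>p f. matrix f $ fst p $ snd p"])
    fix p assume "p \<in> C \<times> C"
    then have "reaches (snd p) i" "reaches i (fst p)" by (auto simp: C_def)
    then have "reaches (snd p) (fst p)" by (rule reaches_trans)
    then show "\<exists>K. \<forall>m f. pattern_map m f \<longrightarrow> matrix f $ fst p $ snd p \<le> K * \<mu> ^ m"
      by (rule component_entry_bound[rotated 2]) (use diag_\<mu> \<mu>(1) in auto)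
  qed (use \<mu> in auto)
  then obtain K where K: "1 \<le> K" and "\<forall>p\<in>C \<times> C. \<forall>m f. pattern_map m f
      \<longrightarrow> matrix f $ fst p $ snd p \<le> K * \<mu> ^ m"
    by blast
  then have entry: "matrix f $ a $ j \<le> K * \<mu> ^ m"
    if "a \<in> C" "j \<in> C" "pattern_map m f" for a j m f
    using that by fastforce
  have "\<exists>E\<ge>1. \<forall>b\<in>R - C. \<forall>n x. value_of_size n x \<longrightarrow> x $ b \<le> E * \<mu> ^ n"
  proof (rule uniform_constant[where h = "\<lambda>b x. x $ b"])
    fix b assume b: "b \<in> R - C"
    then have ib: "reaches i b" "\<not> reaches b i" by (auto simp: R_def C_def)
    have "{j. reaches b j} \<subseteq> {j. reaches i j}" using reaches_trans[OF ib(1)] by blast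
    moreover have "i \<notin> {j. reaches b j}" "i \<in> {j. reaches i j}"
      using ib(2) reaches_refl by auto
    ultimately have "card {j. reaches b j} < card {j. reaches i j}"
      by (intro psubset_card_mono) auto
    then show "\<exists>K. \<forall>n x. value_of_size n x \<longrightarrow> x $ b \<le> K * \<mu> ^ n"
      by (rule less.hyps[OF _ \<mu>(2)])
  qed (use \<mu> in auto)
  then obtain E where E: "1 \<le> E" and
    escape: "\<And>b n x. b \<in> R - C \<Longrightarrow> value_of_size n x \<Longrightarrow> x $ b \<le> E * \<mu> ^ n"
    by blast
  obtain H where H: "1 \<le> H" "\<And>n x i. value_of_size n x \<Longrightarrow> x $ i \<le> H ^ n"
    using value_le_exponential by blast
  define \<alpha> \<beta> where "\<alpha> = K * ((\<Sum>j\<in>UNIV. s $ j) / \<mu>)" and "\<beta> = K * (coeff_sum * E)"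
  have \<alpha>\<beta>: "0 \<le> \<alpha>" "0 \<le> \<beta>"
    using K E \<mu>(1) coeff_sum_nonneg s_nonneg
    by (auto simp: \<alpha>_def \<beta>_def intro!: mult_nonneg_nonneg divide_nonneg_pos sum_nonneg)
  obtain k0 where k0: "\<And>k. k0 \<le> k \<Longrightarrow> \<alpha> + \<beta> * (2 * real k + 1) \<le> \<rho> ^ k"
    using affine_le_geometric[OF \<rho>] by blast
  \<comment> \<open>\<open>L\<close> is at least \<open>E\<close>, for the indices outside \<open>C\<close>, and at least the crude bound \<open>(H / \<nu>) ^ n\<close> at
    every size where the affine factor is not yet dominated.\<close>
  define L where "L = E + (\<Sum>n<2 * k0 + 2. (H / \<nu>) ^ n)"
  have "0 \<le> (\<Sum>n<2 * k0 + 2. (H / \<nu>) ^ n)"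
    using H(1) \<nu>(2) by (intro sum_nonneg) auto
  then have L: "1 \<le> L" "E \<le> L" using E by (auto simp: L_def)
  have small: "H ^ n \<le> L * \<nu> ^ n" if "n < 2 * k0 + 2" for n
  proof -
    have "(H / \<nu>) ^ n \<le> (\<Sum>n<2 * k0 + 2. (H / \<nu>) ^ n)"
      using that H(1) \<nu>(2) by (intro member_le_sum) auto
    then have "(H / \<nu>) ^ n \<le> L" using E by (simp add: L_def)
    then show ?thesis using \<nu>(2) by (simp add: power_divide divide_simps)
  qed
  have bound: "x $ a \<le> L * \<nu> ^ n" if "value_of_size n x" "a \<in> R" for n x a
    using that
  proof (induction n arbitrary: x a rule: less_induct)
    case (less n)
    note x = less.prems(1)
    consider "a \<in> R - C" | "a \<in> C" "n < 2 * k0 + 2" | "a \<in> C" "2 * k0 + 2 \<le> n"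
      using less.prems(2) by force
    then show ?case
    proof cases
      case 1
      then have "x $ a \<le> E * \<mu> ^ n" using escape x by blast
      also have "\<dots> \<le> L * \<nu> ^ n" using E L \<mu> by (intro mult_mono power_mono) auto
      finally show ?thesis .
    next
      case 2
      then show ?thesis using H(2)[OF x, of a] small[of n] by simp
    next
      case 3
      define h where "h = n div 2"
      have h: "k0 \<le> h" "n \<le> 2 * h + 1" "2 * h \<le> n" using 3(2) by (auto simp: h_def)
      define B where "B = L * \<rho> ^ h"
      have B: "1 \<le> B" unfolding B_def using L(1) \<rho> by (intro mult_ge1_I one_le_power) auto
      have light: "z $ b \<le> B * \<mu> ^ k" if "value_of_size k z" "2 * k \<le> n" "b \<in> R" for k z b
      proof -
        have "k < n" "k \<le> h" using that 3(2) by (auto simp: h_def)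
        then have "z $ b \<le> L * \<nu> ^ k" using less.IH that by blast
        also have "\<dots> = L * \<rho> ^ k * \<mu> ^ k" by (simp add: \<nu>(1) power_mult_distrib)
        also have "\<dots> \<le> B * \<mu> ^ k"
          unfolding B_def using \<open>k \<le> h\<close> L(1) \<rho> \<mu>(1)
          by (intro mult_right_mono mult_left_mono power_increasing) auto
        finally show ?thesis .
      qed
      have closed: "b \<in> R \<and> k \<in> R" if "j \<in> C" "0 < c j b k" for j b k
        using that coeff_reaches[OF that(2)] reaches_trans by (auto simp: R_def C_def)
      have "x $ a = (\<Sum>j\<in>C. matrix (\<lambda>u. u) $ a $ j * x $ j)"
        using 3(1) by (simp add: matrix_id_nth if_distrib[of "\<lambda>r. r * _"] cong: if_cong)
      also have "\<dots> \<le> K * ((\<Sum>j\<in>UNIV. s $ j) / \<mu> + real n * (coeff_sum * (B * E))) * \<mu> ^ (0 + n)"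
        using K E B \<mu>(1) entry[OF 3(1)] escape light closed x
        by (intro heavy_path_descent[where N = n and R = R] hole) auto
      also have "\<dots> = (\<alpha> + \<beta> * real n * B) * \<mu> ^ n"
        by (simp add: \<alpha>_def \<beta>_def algebra_simps)
      also have "\<dots> \<le> (\<alpha> * B + \<beta> * (2 * real h + 1) * B) * \<mu> ^ n"
        using \<alpha>\<beta> B h(2) \<mu>(1) mult_left_mono[OF B \<alpha>\<beta>(1)]
        by (intro mult_right_mono add_mono mult_left_mono) auto
      also have "\<dots> = (\<alpha> + \<beta> * (2 * real h + 1)) * B * \<mu> ^ n"
        by (simp add: algebra_simps)
      also have "\<dots> \<le> \<rho> ^ h * B * \<mu> ^ n"
        using k0[OF h(1)] B \<mu>(1) by (intro mult_right_mono) auto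
      also have "\<dots> = L * \<rho> ^ (2 * h) * \<mu> ^ n"
        by (simp add: B_def mult_2 power_add)
      also have "\<dots> \<le> L * \<rho> ^ n * \<mu> ^ n"
        using h(3) L(1) \<rho> \<mu>(1) by (intro mult_right_mono mult_left_mono power_increasing) auto
      also have "\<dots> = L * \<nu> ^ n" by (simp add: \<nu>(1) power_mult_distrib)
      finally show ?thesis .
    qed
  qed
  have "i \<in> R" using reaches_refl by (simp add: R_def)
  then show ?case using bound by blast
qed

section \<open>The growth function and the supremum\<close>

lemma finite_entries: "finite {v $ i |v i. value_of_size n v}"
proof -
  have "{v $ i |v i. value_of_size n v} = (\<lambda>(v, i). v $ i) ` (products op s n \<times> UNIV)" by auto
  then show ?thesis by (simp add: finite_products)
qed

lemma growth_ge: "value_of_size n x \<Longrightarrow> x $ i \<le> growth op s n"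
  unfolding growth_def using finite_entries by (intro Max_ge) auto

lemma growth_le:
  assumes "1 \<le> n" "\<And>x i. value_of_size n x \<Longrightarrow> x $ i \<le> b"
  shows "growth op s n \<le> b"
proof -
  obtain v where "value_of_size n v" using products_nonempty[OF assms(1), of op s] by blast
  then have "{v $ i |v i. value_of_size n v} \<noteq> {}" by blast
  then show ?thesis
    unfolding growth_def using finite_entries assms(2) by (subst Max_le_iff) auto
qed

lemma growth_nonneg: "1 \<le> n \<Longrightarrow> 0 \<le> growth op s n"
  using products_nonempty[of n op s] growth_ge value_nonneg by (meson all_not_in_conv order_trans)

definition diagonal_roots :: "real set" where
  "diagonal_roots = {root m (matrix f $ i $ i) |m f i. pattern_map m f \<and> 1 \<le> m}"

lemma diagonal_roots_nonempty: "diagonal_roots \<noteq> {}"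
  unfolding diagonal_roots_def using pattern_map_op(1)[OF products_generator] by blast

lemma diagonal_roots_nonneg: "d \<in> diagonal_roots \<Longrightarrow> 0 \<le> d"
  unfolding diagonal_roots_def by (auto intro: matrix_nonneg)

text \<open>
  Substituting \<open>s\<close> into the marked leaf of a pattern gives a bracketing, whose value is at most
  exponential in its size. The factor \<open>s $ i\<close> lost in passing to the diagonal entry is absorbed into the
  base of the exponential because the size is at least \<open>1\<close>.
\<close>

lemma bdd_above_diagonal_roots: "bdd_above diagonal_roots"
proof -
  obtain H where H: "1 \<le> H" "\<And>n x i. value_of_size n x \<Longrightarrow> x $ i \<le> H ^ n"
    using value_le_exponential by blast
  define L where "L = 1 + (\<Sum>i\<in>UNIV. H / s $ i)"
  have nn: "0 \<le> H / s $ i" for i using H(1) s_pos[of i] by simp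
  have L: "1 \<le> L" "H / s $ i \<le> L" for i
  proof -
    show "1 \<le> L" using nn by (simp add: L_def sum_nonneg)
    have "H / s $ i \<le> (\<Sum>i\<in>UNIV. H / s $ i)" using nn by (intro member_le_sum) auto
    then show "H / s $ i \<le> L" by (simp add: L_def)
  qed
  have "d \<le> H * L" if "d \<in> diagonal_roots" for d
  proof -
    obtain m f i where f: "pattern_map m f" "1 \<le> m" and d: "d = root m (matrix f $ i $ i)"
      using \<open>d \<in> diagonal_roots\<close> unfolding diagonal_roots_def by blast
    have "matrix f $ i $ i * s $ i \<le> f s $ i"
      using pattern_map_ge_term[OF f(1)] s_nonneg by blast
    also have "\<dots> \<le> H ^ (m + 1)" by (rule H(2)[OF pattern_map_value[OF f(1) products_generator]])
    finally have "matrix f $ i $ i \<le> H ^ m * (H / s $ i)" using s_pos[of i] by (simp add: field_simps)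
    also have "\<dots> \<le> H ^ m * L ^ m"
      using L(1) L(2)[of i] H(1) f(2) self_le_power[of L m] by (intro mult_left_mono) auto
    finally have "matrix f $ i $ i \<le> (H * L) ^ m" by (simp add: power_mult_distrib)
    then have "d \<le> root m ((H * L) ^ m)" using f(2) d by simp
    also have "\<dots> = H * L" using f(2) H(1) L(1) by (intro real_root_power_cancel) auto
    finally show ?thesis .
  qed
  then show ?thesis by (rule bdd_aboveI)
qed

lemma pattern_map_0: "pattern_map 0 f \<Longrightarrow> f = (\<lambda>u. u)"
  by (erule pattern_map.cases) auto

lemma diagonal_le_Sup_power:
  assumes "pattern_map m f"
  shows "matrix f $ i $ i \<le> Sup diagonal_roots ^ m"
proof (cases "m = 0")
  case True
  then have "f = (\<lambda>u. u)" using pattern_map_0 assms by simp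
  then show ?thesis using True by (simp add: matrix_id_nth)
next
  case False
  let ?d = "root m (matrix f $ i $ i)"
  have d: "?d \<in> diagonal_roots" using assms False by (auto simp: diagonal_roots_def Suc_le_eq)
  have "matrix f $ i $ i = ?d ^ m"
    using False matrix_nonneg[OF assms] by simp
  also have "\<dots> \<le> Sup diagonal_roots ^ m"
    using d bdd_above_diagonal_roots diagonal_roots_nonneg by (intro power_mono cSup_upper) auto
  finally show ?thesis .
qed

lemma root_const_times_power:
  assumes "0 < \<kappa>" "0 \<le> a"
  shows "(\<lambda>n. root n (\<kappa> * a ^ n)) \<longlonglongrightarrow> a"
proof -
  have "(\<lambda>n. root n \<kappa> * a) \<longlonglongrightarrow> 1 * a"
    using assms by (intro tendsto_intros LIMSEQ_root_const)
  moreover have "\<forall>\<^sub>F n in sequentially. root n \<kappa> * a = root n (\<kappa> * a ^ n)"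
    using eventually_gt_at_top[of 0]
    by eventually_elim (use assms in \<open>simp add: real_root_mult real_root_power_cancel\<close>)
  ultimately show ?thesis by (simp add: tendsto_cong)
qed

lemma root_growth_tendsto: "(\<lambda>n. root n (growth op s n)) \<longlonglongrightarrow> Sup diagonal_roots"
proof (rule order_tendstoI)
  let ?\<theta> = "Sup diagonal_roots"
  have \<theta>: "0 \<le> ?\<theta>"
    using diagonal_roots_nonempty diagonal_roots_nonneg bdd_above_diagonal_roots
    by (meson cSup_upper2 ex_in_conv)
  fix e
  show "\<forall>\<^sub>F n in sequentially. e < root n (growth op s n)" if e: "e < ?\<theta>"
  proof -
    obtain a where a: "a \<in> diagonal_roots" "e < a"
      using less_cSupD[OF diagonal_roots_nonempty e] by blast
    show ?thesis
    proof (cases "a = 0")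
      case True
      show ?thesis
        using eventually_ge_at_top[of 1]
      proof eventually_elim
        case (elim n)
        have "0 \<le> root n (growth op s n)" using growth_nonneg[OF elim] elim by simp
        then show ?case using True a(2) by simp
      qed
    next
      case False
      then have "0 < a" using diagonal_roots_nonneg[OF a(1)] by simp
      obtain m f i where f: "pattern_map m f" "1 \<le> m" and d: "a = root m (matrix f $ i $ i)"
        using a(1) unfolding diagonal_roots_def by blast
      have "matrix f $ i $ i = a ^ m"
        using d f matrix_nonneg[OF f(1)] by simp
      from values_ge_geometric[OF f \<open>0 < a\<close> this] obtain \<kappa> where "0 < \<kappa>"
        and \<kappa>: "\<And>n. 1 \<le> n \<Longrightarrow> \<exists>x. value_of_size n x \<and> \<kappa> * a ^ n \<le> x $ i" by blast
      have "\<forall>\<^sub>F n in sequentially. e < root n (\<kappa> * a ^ n)"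
        using root_const_times_power[OF \<open>0 < \<kappa>\<close>, of a] \<open>0 < a\<close> a(2) by (auto dest: order_tendstoD(1))
      then show ?thesis
        using eventually_ge_at_top[of 1]
      proof eventually_elim
        case (elim n)
        have "\<kappa> * a ^ n \<le> growth op s n" using \<kappa>[OF elim(2)] growth_ge by (meson order_trans)
        then have "root n (\<kappa> * a ^ n) \<le> root n (growth op s n)" using elim(2) by simp
        then show ?case using elim(1) by simp
      qed
    qed
  qed
  show "\<forall>\<^sub>F n in sequentially. root n (growth op s n) < e" if "?\<theta> < e"
  proof -
    define \<nu> where "\<nu> = (?\<theta> + e) / 2"
    have \<nu>: "?\<theta> < \<nu>" "\<nu> < e" "0 \<le> \<nu>" using that \<theta> by (auto simp: \<nu>_def)
    have "\<exists>K\<ge>1. \<forall>i\<in>UNIV. \<forall>n x. value_of_size n x \<longrightarrow> x $ i \<le> K * \<nu> ^ n"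
    proof (rule uniform_constant[where h = "\<lambda>i x. x $ i"])
      fix i
      show "\<exists>K. \<forall>n x. value_of_size n x \<longrightarrow> x $ i \<le> K * \<nu> ^ n"
        using diagonal_le_Sup_power \<theta> \<nu>(1) by (rule value_bound_above_diagonal_rate)
    qed (use \<nu> in auto)
    then obtain K where K: "1 \<le> K" "\<And>n x i. value_of_size n x \<Longrightarrow> x $ i \<le> K * \<nu> ^ n"
      by blast
    have "\<forall>\<^sub>F n in sequentially. root n (K * \<nu> ^ n) < e"
      using root_const_times_power[of K \<nu>] K(1) \<nu> by (auto dest: order_tendstoD(2))
    then show ?thesis
      using eventually_ge_at_top[of 1]
    proof eventually_elim
      case (elim n)
      have "root n (growth op s n) \<le> root n (K * \<nu> ^ n)"
        using growth_le[OF elim(2) K(2)] elim(2) by simp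
      then show ?case using elim(1) by simp
    qed
  qed
qed

lemma pattern_root_in_diagonal_roots:
  assumes "P \<in> linear_patterns" "1 \<le> pattern_size P"
  shows "root (pattern_size P) (pattern_matrix op s P $ i $ i) \<in> diagonal_roots"
proof -
  have "pattern_map (pattern_size P) (pattern_val op s P)"
    using assms(1) pattern_val_is_pattern_map by (auto simp: linear_patterns_def)
  then show ?thesis using assms(2) unfolding diagonal_roots_def pattern_matrix_def by blast
qed

text \<open>
  The supremum of the statement lives in the extended reals and takes a maximum over \<open>i\<close> first; by
  boundedness it is real, and it has the same upper bounds as the set of all individual roots.
\<close>

lemma SUP_pattern_roots:
  "ereal (Sup diagonal_roots) = (SUP P \<in> {P \<in> linear_patterns. pattern_size P \<ge> 1}.
     ereal (MAX i. root (pattern_size P) (pattern_matrix op s P $ i $ i)))"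
  (is "_ = (SUP P \<in> ?A. ereal (?M P))")
proof (rule antisym)
  show upper: "(SUP P \<in> ?A. ereal (?M P)) \<le> ereal (Sup diagonal_roots)"
  proof (rule SUP_least)
    fix P assume "P \<in> ?A"
    then have "root (pattern_size P) (pattern_matrix op s P $ i $ i) \<le> Sup diagonal_roots" for i
      using pattern_root_in_diagonal_roots bdd_above_diagonal_roots by (intro cSup_upper) auto
    then show "ereal (?M P) \<le> ereal (Sup diagonal_roots)" by simp
  qed
  have le: "ereal d \<le> (SUP P \<in> ?A. ereal (?M P))" if d: "d \<in> diagonal_roots" for d
  proof -
    obtain m f i where f: "pattern_map m f" "1 \<le> m" "d = root m (matrix f $ i $ i)"
      using d unfolding diagonal_roots_def by blast
    then obtain P where P: "P \<in> ?A" "d = root (pattern_size P) (pattern_matrix op s P $ i $ i)"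
      using pattern_map_is_pattern_val[OF f(1)] unfolding pattern_matrix_def by blast
    then have "d \<le> ?M P" by (auto intro!: Max_ge)
    then show ?thesis using P(1) by (intro SUP_upper2[of P]) auto
  qed
  obtain d0 where "d0 \<in> diagonal_roots" using diagonal_roots_nonempty by blast
  with le upper obtain r where r: "(SUP P \<in> ?A. ereal (?M P)) = ereal r"
    by (cases "SUP P \<in> ?A. ereal (?M P)") force+
  have "Sup diagonal_roots \<le> r"
    using le diagonal_roots_nonempty unfolding r by (intro cSup_least) auto
  then show "ereal (Sup diagonal_roots) \<le> (SUP P \<in> ?A. ereal (?M P))" unfolding r by simp
qed

end

theorem corollary2:
  fixes s :: "real ^ 'd" and op :: "real ^ 'd \<Rightarrow> real ^ 'd \<Rightarrow> real ^ 'd"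
  assumes "\<And>i. s $ i > 0"
    and "nonneg_bilinear op"
  shows "\<exists>lam::real. (\<lambda>n. root n (growth op s n)) \<longlonglongrightarrow> lam \<and>
           ereal lam = (SUP P \<in> {P \<in> linear_patterns. pattern_size P \<ge> 1}.
             ereal (MAX i. root (pattern_size P) (pattern_matrix op s P $ i $ i)))"
proof -
  obtain c where "\<And>k i j. 0 \<le> c k i j"
    and "\<And>x y k. op x y $ k = (\<Sum>i\<in>UNIV. \<Sum>j\<in>UNIV. c k i j * x $ i * y $ j)"
    using assms(2) unfolding nonneg_bilinear_def by blast
  then interpret nonneg_product op s c
    using assms(1) by unfold_locales auto
  show ?thesis using root_growth_tendsto SUP_pattern_roots by blast
qed

end
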